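(* Let $f$ be as defined in the context. Then $f(n-1,a)=f(n,a)$ for all $n,a\in\mathbb{N}^+$ with $n>a$.
   Context: A family $\mathcal{F}$ on ground set $[n]=\{1,\dots,n\}$ is a collection $\mathcal{S}(\mathcal{F})$ of distinct subsets of $[n]$ (elements of $[n]$ may lie in no set); $m(\mathcal{F})=|\mathcal{S}(\mathcal{F})|$. It is union-closed if $S\cup T\in\mathcal{S}(\mathcal{F})$ whenever $S,T\in\mathcal{S}(\mathcal{F})$. For $e\in[n]$, $m_e(\mathcal{F})$ is the number of sets of $\mathcal{F}$ containing $e$, and $a(\mathcal{F})=\max_{e\in[n]}m_e(\mathcal{F})$. For $n,a\in\mathbb{N}^+$, $f(n,a)$ is the maximum of $m(\mathcal{F})$ over all union-closed families $\mathcal{F}$ on ground set $[n]$ with $\mathcal{S}(\mathcal{F})\neq\emptyset$ and $a(\mathcal{F})\le a$. *)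

theory Defs
  imports Main
begin

definition union_closed :: "'a set set \<Rightarrow> bool" where
  "union_closed F \<longleftrightarrow> (\<forall>S\<in>F. \<forall>T\<in>F. S \<union> T \<in> F)"

definition family_on :: "nat \<Rightarrow> nat set set \<Rightarrow> bool" where
  "family_on n F \<longleftrightarrow> F \<subseteq> Pow {1..n}"

definition elem_freq :: "'a set set \<Rightarrow> 'a \<Rightarrow> nat" where
  "elem_freq F e = card {S \<in> F. e \<in> S}"

text \<open>The ground set is a parameter because a family need not cover it. The maximum is
  meaningful for \<open>n \<ge> 1\<close> only.\<close>

definition max_freq :: "nat \<Rightarrow> nat set set \<Rightarrow> nat" where
  "max_freq n F = Max (elem_freq F ` {1..n})"

text \<open>For \<open>n \<ge> 1\<close> the maximum ranges over a finite nonempty set: the number of sets in a family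
  on \<open>{1..n}\<close> is at most \<open>2 ^ n\<close>, and the family \<open>{{}}\<close> is always admissible.\<close>

definition max_size :: "nat \<Rightarrow> nat \<Rightarrow> nat" where
  "max_size n a =
     Max {card F | F. family_on n F \<and> union_closed F \<and> F \<noteq> {} \<and> max_freq n F \<le> a}"

end

(* If every element of the n-element ground set has frequency below n, some element x can be
   deleted without identifying two members of the family. Otherwise every element is covered and
   distinct elements lie in different members. Let y have maximal frequency, and for x \<noteq> y let T x be
   the union of the members avoiding x. Maximality gives y \<in> T x, so each T x is a member; these
   n - 1 sets are distinct, and none of them is the union of the whole family. Hence y has frequency
   at least n. *)

theory Submission
  imports Defs
begin

lemma union_closed_Union:
  assumes "union_closed F" and "finite G" and "G \<noteq> {}" and "G \<subseteq> F"
  shows "\<Union>G \<in> F"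
  using assms(2-4)
proof (induction rule: finite_ne_induct)
  case (insert S G)
  then show ?case
    using assms(1) by (auto simp: union_closed_def)
qed simp

text \<open>For \<open>n = 0\<close> the maximum would range over the empty set, where
  \<open>Max\<close> has no useful value.\<close>

lemma max_freq_le_iff:
  assumes "n \<ge> 1"
  shows "max_freq n F \<le> a \<longleftrightarrow> (\<forall>e\<in>{1..n}. elem_freq F e \<le> a)"
  using assms by (auto simp: max_freq_def)

lemma exists_redundant_element:
  fixes F :: "'a set set"
  assumes "finite X" and "X \<noteq> {}" and sub: "F \<subseteq> Pow X" and uc: "union_closed F"
    and freq: "\<forall>e\<in>X. elem_freq F e < card X"
  shows "\<exists>x\<in>X. (\<forall>S\<in>F. x \<notin> S) \<or> (\<exists>y\<in>X - {x}. \<forall>S\<in>F. x \<in> S \<longleftrightarrow> y \<in> S)"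
proof (rule ccontr)
  assume irredundant: "\<not> ?thesis"
  then have covered: "\<exists>S\<in>F. x \<in> S" if "x \<in> X" for x
    using irredundant that by blast
  have separated: "x = y" if "x \<in> X" "y \<in> X" "\<forall>S\<in>F. x \<in> S \<longleftrightarrow> y \<in> S" for x y
    using irredundant that by blast
  have fin: "finite F"
    using sub \<open>finite X\<close> by (meson finite_Pow_iff finite_subset)
  define T where "T x = \<Union>{S \<in> F. x \<notin> S}" for x
  have "Max (elem_freq F ` X) \<in> elem_freq F ` X"
    using assms(1,2) by (intro Max_in) auto
  then obtain y where y: "y \<in> X" and y_Max: "elem_freq F y = Max (elem_freq F ` X)"
    by (metis imageE)
  then have y_max: "\<forall>x\<in>X. elem_freq F x \<le> elem_freq F y"
    using \<open>finite X\<close> by simp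
  have y_in: "y \<in> T x" if "x \<in> X - {y}" for x
  proof (rule ccontr)
    assume "y \<notin> T x"
    \<comment> \<open>Every member avoiding \<open>x\<close> lies inside \<open>T x\<close>, so it
      avoids \<open>y\<close> too. Maximality of \<open>y\<close> turns the resulting inclusion into
      an equality, and \<open>x\<close> and \<open>y\<close> would not be separated.\<close>
    then have "{S \<in> F. y \<in> S} \<subseteq> {S \<in> F. x \<in> S}"
      by (auto simp: T_def)
    moreover have "card {S \<in> F. x \<in> S} \<le> card {S \<in> F. y \<in> S}"
      using y_max that by (auto simp: elem_freq_def)
    ultimately have "{S \<in> F. y \<in> S} = {S \<in> F. x \<in> S}"
      using fin by (intro card_seteq) auto
    then show False
      using separated[of x y] y that by blast
  qed
  \<comment> \<open>If no member avoided \<open>x\<close>, then \<open>T x\<close> would be an empty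
    union, possibly outside \<open>F\<close>. The point \<open>y\<close> in \<open>T x\<close> rules
    this out.\<close>
  have T_mem: "T x \<in> F" if "x \<in> X - {y}" for x
    unfolding T_def using y_in[OF that] fin
    by (intro union_closed_Union[OF uc]) (auto simp: T_def)
  have "F \<noteq> {}"
    using covered y by blast
  then have U_mem: "\<Union>F \<in> F"
    using union_closed_Union[OF uc fin] by simp
  have "inj_on T (X - {y})"
  proof (rule inj_onI)
    fix u v assume uv: "u \<in> X - {y}" "v \<in> X - {y}" "T u = T v"
    \<comment> \<open>A set \<open>T u\<close> never contains \<open>u\<close>. Members avoiding
      \<open>v\<close> lie inside \<open>T v\<close>, which equals \<open>T u\<close>, so they avoid
      \<open>u\<close>; the converse is symmetric.\<close>
    have "u \<notin> T v" "v \<notin> T u"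
      using uv(3) unfolding T_def by blast+
    then have "\<forall>S\<in>F. u \<in> S \<longleftrightarrow> v \<in> S"
      unfolding T_def by blast
    then show "u = v"
      using separated uv by blast
  qed
  then have "card (T ` (X - {y})) = card X - 1"
    using y by (simp add: card_image \<open>finite X\<close>)
  \<comment> \<open>Each \<open>x\<close> is covered, so it lies in the full union but not in
    \<open>T x\<close>.\<close>
  moreover have "\<Union>F \<notin> T ` (X - {y})"
    using covered by (fastforce simp: T_def)
  moreover have "card X > 0"
    using assms(1,2) by (simp add: card_gt_0_iff)
  ultimately have "card (insert (\<Union>F) (T ` (X - {y}))) = card X"
    using \<open>finite X\<close> by simp
  moreover have "card (insert (\<Union>F) (T ` (X - {y}))) \<le> elem_freq F y"
    unfolding elem_freq_def
  proof (intro card_mono insert_subsetI image_subsetI CollectI conjI)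
    show "y \<in> \<Union>F"
      using covered[OF y] by blast
  qed (use fin U_mem T_mem y_in in simp_all)
  ultimately have "card X \<le> elem_freq F y"
    by simp
  then show False
    using freq y by (meson leD)
qed

text \<open>Each image set containing \<open>i\<close> comes from a member containing
  \<open>j\<close>, and taking images cannot increase cardinality.\<close>

lemma elem_freq_image_le:
  assumes "finite F" and "\<And>S. S \<in> F \<Longrightarrow> i \<in> g S \<Longrightarrow> j \<in> S"
  shows "elem_freq (g ` F) i \<le> elem_freq F j"
proof -
  have "{T \<in> g ` F. i \<in> T} \<subseteq> g ` {S \<in> F. j \<in> S}"
    using assms(2) by blast
  then show ?thesis
    unfolding elem_freq_def using \<open>finite F\<close> by (intro surj_card_le) simp_all
qed

lemma exists_family_on_pred:
  assumes n: "n > a" "a \<ge> 1"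
    and fam: "family_on n F" and uc: "union_closed F" and "max_freq n F \<le> a"
  obtains F' where "family_on (n - 1) F'" "union_closed F'" "max_freq (n - 1) F' \<le> a"
    "card F' = card F"
proof -
  have freq: "\<forall>e\<in>{1..n}. elem_freq F e \<le> a"
    using assms max_freq_le_iff[of n F a] by simp
  have sub: "F \<subseteq> Pow {1..n}"
    using fam by (simp add: family_on_def)
  then have fin: "finite F"
    by (meson finite_Pow_iff finite_atLeastAtMost finite_subset)
  have "\<exists>x\<in>{1..n}. (\<forall>S\<in>F. x \<notin> S) \<or> (\<exists>y\<in>{1..n} - {x}. \<forall>S\<in>F. x \<in> S \<longleftrightarrow> y \<in> S)"
  proof (rule exists_redundant_element[OF _ _ sub uc])
    show "\<forall>e\<in>{1..n}. elem_freq F e < card {1..n}"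
      using n freq by (metis card_atLeastAtMost diff_Suc_1 le_less_trans)
  qed (use n in auto)
  then obtain x where x: "x \<in> {1..n}"
    and red: "(\<forall>S\<in>F. x \<notin> S) \<or> (\<exists>y\<in>{1..n} - {x}. \<forall>S\<in>F. x \<in> S \<longleftrightarrow> y \<in> S)"
    by blast
  \<comment> \<open>Once \<open>x\<close> is deleted its label is free and is given to
    \<open>n\<close>, so that the ground set is again an initial segment. If \<open>x = n\<close>,
    no label in \<open>{1..n - 1}\<close> changes.\<close>
  define h where "h i = (if i = x then n else i)" for i
  have h_image: "h ` {1..n - 1} = {1..n} - {x}"
  proof
    show "h ` {1..n - 1} \<subseteq> {1..n} - {x}"
      using n x by (auto simp: h_def)
    show "{1..n} - {x} \<subseteq> h ` {1..n - 1}"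
    proof
      fix j assume j: "j \<in> {1..n} - {x}"
      show "j \<in> h ` {1..n - 1}"
      proof (cases "j = n")
        case True
        then show ?thesis
          using j x by (intro image_eqI[of _ _ x]) (auto simp: h_def)
      next
        case False
        then show ?thesis
          using j by (intro image_eqI[of _ _ j]) (auto simp: h_def)
      qed
    qed
  qed
  \<comment> \<open>Deletion and relabelling together form a preimage under \<open>h\<close>, which
    commutes with unions.\<close>
  define g where "g S = {i \<in> {1..n - 1}. h i \<in> S}" for S
  have "inj_on g F"
  proof (rule inj_onI)
    fix S T assume ST: "S \<in> F" "T \<in> F" "g S = g T"
    have "\<forall>i\<in>{1..n - 1}. h i \<in> S \<longleftrightarrow> h i \<in> T"
      using ST(3) unfolding g_def by blast
    then have "\<forall>j\<in>h ` {1..n - 1}. j \<in> S \<longleftrightarrow> j \<in> T"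
      by blast
    then have agree: "\<forall>j\<in>{1..n} - {x}. j \<in> S \<longleftrightarrow> j \<in> T"
      unfolding h_image .
    \<comment> \<open>Membership of \<open>x\<close> is either constantly false or copied from some
      \<open>y\<close> that survives the deletion.\<close>
    moreover have "x \<in> S \<longleftrightarrow> x \<in> T"
      using red agree ST(1,2) by blast
    moreover have "S \<subseteq> {1..n}" "T \<subseteq> {1..n}"
      using sub ST(1,2) by blast+
    ultimately show "S = T"
      by (metis DiffI singletonD subsetD subset_antisym subsetI)
  qed
  have "elem_freq (g ` F) i \<le> a" if "i \<in> {1..n - 1}" for i
  proof -
    have "elem_freq (g ` F) i \<le> elem_freq F (h i)"
      by (rule elem_freq_image_le[OF fin]) (simp add: g_def)
    moreover have "h i \<in> {1..n}"
      using h_image that by blast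
    ultimately show ?thesis
      using freq le_trans by blast
  qed
  \<comment> \<open>From \<open>n > a\<close> and \<open>a \<ge> 1\<close>: the smaller ground set
    is still nonempty, so its maximum is meaningful.\<close>
  moreover have "n - 1 \<ge> 1"
    using n by simp
  ultimately have "max_freq (n - 1) (g ` F) \<le> a"
    by (simp add: max_freq_le_iff)
  moreover have "family_on (n - 1) (g ` F)"
    by (auto simp: family_on_def g_def)
  moreover have "union_closed (g ` F)"
  proof -
    have "g S \<union> g T = g (S \<union> T)" for S T
      by (auto simp: g_def)
    then show ?thesis
      using uc by (auto simp: union_closed_def)
  qed
  ultimately show ?thesis
    using that[of "g ` F"] card_image[OF \<open>inj_on g F\<close>] by simp
qed

text \<open>The added point \<open>n\<close> lies in no member and has frequency 0, so enlarging the
  ground set cannot break the bound.\<close>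

lemma family_on_pred_imp:
  assumes "n \<ge> 2" and fam: "family_on (n - 1) F" and "max_freq (n - 1) F \<le> a"
  shows "family_on n F" and "max_freq n F \<le> a"
proof -
  have sub: "F \<subseteq> Pow {1..n - 1}"
    using fam by (simp add: family_on_def)
  moreover have "{1..n - 1} \<subseteq> {1..n}"
    by simp
  ultimately show "family_on n F"
    unfolding family_on_def by blast
  have freq: "\<forall>e\<in>{1..n - 1}. elem_freq F e \<le> a"
    using assms max_freq_le_iff[of "n - 1" F a] by simp
  have "{S \<in> F. n \<in> S} = {}"
  proof -
    have "n \<notin> {1..n - 1}"
      using \<open>n \<ge> 2\<close> by simp
    then show ?thesis
      using sub by blast
  qed
  then have "elem_freq F n = 0"
    by (simp only: elem_freq_def card.empty)
  then have "elem_freq F e \<le> a" if "e \<in> {1..n}" for e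
    using freq that by (cases "e = n") auto
  then show "max_freq n F \<le> a"
    using \<open>n \<ge> 2\<close> by (simp add: max_freq_le_iff)
qed

theorem theorem3p3:
  fixes n a :: nat
  assumes "n \<ge> 1" and "a \<ge> 1" and "n > a"
  shows "max_size (n - 1) a = max_size n a"
proof -
  \<comment> \<open>The sets of attainable sizes themselves coincide, which gives equal maxima at
    once.\<close>
  let ?sizes = "\<lambda>k. {card F | F. family_on k F \<and> union_closed F \<and> F \<noteq> {} \<and> max_freq k F \<le> a}"
  have "?sizes (n - 1) \<subseteq> ?sizes n"
  proof -
    have "n \<ge> 2"
      using assms by simp
    then show ?thesis
      using family_on_pred_imp by blast
  qed
  moreover have "?sizes n \<subseteq> ?sizes (n - 1)"
  proof
    fix c assume "c \<in> ?sizes n"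
    then obtain F where F: "c = card F" "family_on n F" "union_closed F" "F \<noteq> {}" "max_freq n F \<le> a"
      by blast
    then obtain F' where F': "family_on (n - 1) F'" "union_closed F'" "max_freq (n - 1) F' \<le> a"
      "card F' = card F"
      using exists_family_on_pred assms(2,3) by metis
    have "finite F"
      using F(2) unfolding family_on_def by (meson finite_Pow_iff finite_atLeastAtMost finite_subset)
    \<comment> \<open>As \<open>F\<close> is finite and nonempty, its cardinality, shared by
      \<open>F'\<close>, is positive.\<close>
    then have "F' \<noteq> {}"
      using F(4) F'(4) by auto
    then show "c \<in> ?sizes (n - 1)"
      using F(1) F' by (metis (mono_tags, lifting) mem_Collect_eq)
  qed
  ultimately have "?sizes (n - 1) = ?sizes n"
    by (rule subset_antisym)
  then show ?thesis
    by (simp only: max_size_def)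
qed

end
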